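(* Let $q\in\{0,2,4,6,\dots\}$. For any $0<a<\frac{1}{A_q}$, let $E_q=2\sqrt{1-a^2A_q^2}$. Suppose $E\in S_q$ and $E\in(-2,-E_q)\cup(E_q,2)$. Then for any $\theta\in[0,\pi]$, there exist potentials $V:\mathbb{N}\to\mathbb{R}$ such that $\limsup_{n\to\infty}|nV(n)|=a$ and $E$ is an eigenvalue of the associated Schrödinger operator $H=H_0+V$ with boundary condition $\frac{u(1)}{u(0)}=\tan\theta$.
   Context: Here $\mathbb{N}=\{1,2,\dots\}$. The half-line discrete Schrödinger operator $H=H_0+V$ with boundary condition $\theta\in[0,\pi]$ is given by $(Hu)(n)=u(n+1)+u(n-1)+V(n)u(n)$ for $n\ge 1$, with $\frac{u(1)}{u(0)}=\tan\theta$ (i.e. $u(1)\cos\theta=u(0)\sin\theta$). A number $E$ is an eigenvalue if there is a nontrivial solution $u$ of $u(n+1)+u(n-1)+V(n)u(n)=Eu(n)$ ($n\ge1$) satisfying the boundary condition with $u\in\ell^2(\mathbb{N})$. For $E\in(-2,2)$, $k(E)\in(0,1)$ is defined by $E=2\cos\pi k(E)$. For an integer $q\ge2$, $S_q=\{E\in(-2,2): k(E)=p/q \text{ for some } p\in\{1,\dots,q-1\} \text{ with } \gcd(p,q)=1\}$, and $S_0=\{E\in(-2,2): k(E)\text{ is irrational}\}$. The constants are: $A_0=\frac{2}{\pi}$; for even $q\ge2$, $A_q=\frac{2}{q\sin(\pi/q)}$. *)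

theory Defs
  imports "HOL-Analysis.Infinite_Sum" "HOL-Library.Extended_Real"
begin

text \<open>
  The half-line \<open>\<nat> = {1,2,\<dots>}\<close> is represented by the indices \<open>n \<ge> 1\<close> of type \<^typ>\<open>nat\<close>; a
  potential is a function \<^typ>\<open>nat \<Rightarrow> real\<close> whose value at \<open>0\<close> is never used, while the value
  \<open>u 0\<close> of a solution enters through the boundary condition and the equation at \<open>n = 1\<close>.
\<close>

definition schroedinger_op :: "(nat \<Rightarrow> real) \<Rightarrow> (nat \<Rightarrow> complex) \<Rightarrow> nat \<Rightarrow> complex" where
  "schroedinger_op V u n = u (n + 1) + u (n - 1) + of_real (V n) * u n"

definition boundary_condition :: "real \<Rightarrow> (nat \<Rightarrow> complex) \<Rightarrow> bool" where
  \<comment> \<open>\<open>u 1 / u 0 = tan \<theta>\<close>, written so that \<open>\<theta> = \<pi>/2\<close> means \<open>u 0 = 0\<close>\<close>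
  "boundary_condition \<theta> u \<longleftrightarrow> u 1 * of_real (cos \<theta>) = u 0 * of_real (sin \<theta>)"

definition square_summable :: "(nat \<Rightarrow> complex) \<Rightarrow> bool" where
  "square_summable u \<longleftrightarrow> (\<lambda>n. (cmod (u n))\<^sup>2) summable_on {1..}"

definition is_eigenvalue :: "(nat \<Rightarrow> real) \<Rightarrow> real \<Rightarrow> real \<Rightarrow> bool" where
  "is_eigenvalue V \<theta> E \<longleftrightarrow>
     (\<exists>u. u \<noteq> (\<lambda>_. 0) \<and>
          (\<forall>n\<ge>1. schroedinger_op V u n = of_real E * u n) \<and>
          boundary_condition \<theta> u \<and> square_summable u)"

definition quasimomentum :: "real \<Rightarrow> real" where
  "quasimomentum E = (THE k. 0 < k \<and> k < 1 \<and> E = 2 * cos (pi * k))"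

lemma quasimomentum_ex1:
  assumes "-2 < E" "E < 2"
  shows "\<exists>!k. 0 < k \<and> k < 1 \<and> E = 2 * cos (pi * k)"
proof (rule ex1I)
  let ?k = "arccos (E / 2) / pi"
  have "0 < arccos (E / 2)" "arccos (E / 2) < pi"
    using arccos_lt_bounded[of "E / 2"] assms by auto
  then show "0 < ?k \<and> ?k < 1 \<and> E = 2 * cos (pi * ?k)"
    using assms by (simp add: cos_arccos)
next
  fix k :: real
  assume k: "0 < k \<and> k < 1 \<and> E = 2 * cos (pi * k)"
  then have "arccos (E / 2) = pi * k"
    by (simp add: arccos_cos)
  then show "k = arccos (E / 2) / pi" by simp
qed

definition energy_set :: "nat \<Rightarrow> real set" where
  "energy_set q = (if q = 0 then {E \<in> {-2<..<2}. quasimomentum E \<notin> \<rat>}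
          else {E \<in> {-2<..<2}. \<exists>p\<in>{1..q - 1}. coprime p q \<and> quasimomentum E = real p / real q})"

definition A_const :: "nat \<Rightarrow> real" where
  \<comment> \<open>only meant for even \<open>q\<close>\<close>
  "A_const q = (if q = 0 then 2 / pi else 2 / (real q * sin (pi / real q)))"

definition E_threshold :: "nat \<Rightarrow> real \<Rightarrow> real" where
  "E_threshold q a = 2 * sqrt (1 - a\<^sup>2 * (A_const q)\<^sup>2)"

end

theory Submission
  imports Defs "HOL-Analysis.Analysis" "HOL-Real_Asymp.Real_Asymp"
begin

text \<open>
  Write \<open>E = 2 * cos \<eta>\<close> with \<open>\<eta> = pi * k\<close>. A real solution \<open>u\<close> is encoded by complex numbers \<open>w n\<close>
  with \<open>Im (w n) = sin \<eta> * u n\<close> which evolve by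
  \<open>w (n + 1) = cis \<eta> * (w n - V n / sin \<eta> * Im (w n))\<close>: without a potential, \<open>w\<close> merely rotates.
  If \<open>V n = a * c n / n\<close> with \<open>\<bar>c n\<bar> \<le> 1\<close> and \<open>\<phi> n\<close> denotes the phase of \<open>w n\<close>, then to first order
  \<open>ln \<bar>w n\<bar>\<^sup>2\<close> decreases by \<open>a / (n * sin \<eta>) * c n * sin (2 * \<phi> n)\<close> in one step. The best choice is
  therefore \<open>c n = sgn (sin (2 * \<phi> n))\<close>, and \<open>\<bar>w n\<bar>\<^sup>2\<close> decays like \<open>n\<close> to the power
  \<open>- a * A / sin \<eta>\<close>, where \<open>A\<close> is the mean of \<open>\<bar>sin\<bar>\<close> over the doubled phases. The hypotheses on
  \<open>a\<close> and \<open>E\<close> say exactly that \<open>sin \<eta> < a * A_const q\<close>, so that the solution is square summable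
  as soon as the mean \<open>A_const q\<close> is attained.

  If \<open>k\<close> is irrational, the doubled phases equidistribute, the mean is \<open>2 / pi\<close> wherever the orbit
  starts, and a slowly varying perturbation does not affect this. So \<open>V\<close> can be defined by feedback,
  \<open>V n\<close> being \<open>a / n\<close> times the sign of \<open>Re (w n) * Im (w n)\<close>, with the initial value dictated by the
  boundary condition (\<open>irrational_energy_eigenvalue\<close>; the decay is \<open>feedback_orbit_square_summable\<close>).

  If \<open>k = p / q\<close> with \<open>q\<close> even, the doubled phases run through the vertices of a regular
  \<open>q\<close>-gon, and the mean depends on the position of the \<open>q\<close>-gon; it takes its largest value \<open>A_const q\<close>
  when the real axis bisects two of the sides. This position has to be maintained although the potential
  also moves the phase. Evenness of \<open>q\<close> helps: antipodal vertices receive opposite signs, and the phase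
  shifts cancel over a period. Instead of a feedback, a solution is written down in the
  manner of Wigner and von Neumann as \<open>n powr - \<kappa> * (\<alpha> n + \<beta> n / n)\<close> with \<open>\<alpha>\<close> a free solution at the
  optimal phase and \<open>\<beta>\<close> a bounded correction, and the potential is read off from it
  (\<open>wigner_von_neumann_ansatz\<close>, \<open>rational_decaying_tail\<close>). The cancellation over a period is what makes
  \<open>\<beta>\<close> bounded (\<open>resonant_periodic_sums\<close>). As this fixes \<open>u\<close> for large \<open>n\<close>, the boundary condition is
  met by changing finitely many values of \<open>V\<close> (\<open>prescribed_tail\<close>).
\<close>

section \<open>Sums over the vertices of a regular polygon\<close>

text \<open>
  Multiplication by the sine of half the step makes the sum telescope.
\<close>

lemma sum_sin_half_circle:
  fixes x :: real
  assumes "N > 0"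
  shows "(\<Sum>m<N. sin (x + pi * real m / real N)) * sin (pi / (2 * real N)) = cos (x - pi / (2 * real N))"
proof -
  define d where "d = pi / (2 * real N)"
  have d: "pi * real m / real N = 2 * real m * d" for m
    by (simp add: d_def)
  have step: "sin (x + 2 * real m * d) * sin d
      = (cos (x - d + 2 * real m * d) - cos (x - d + 2 * real (Suc m) * d)) / 2" for m
  proof -
    have "x - d + 2 * real m * d = x + 2 * real m * d - d"
      "x - d + 2 * real (Suc m) * d = x + 2 * real m * d + d"
      by (simp_all add: algebra_simps)
    then show ?thesis
      by (simp only: sin_times_sin)
  qed
  have "(\<Sum>m<N. sin (x + 2 * real m * d)) * sin d
      = (\<Sum>m<N. cos (x - d + 2 * real m * d) - cos (x - d + 2 * real (Suc m) * d)) / 2"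
    by (simp only: sum_distrib_right sum_divide_distrib step)
  also have "\<dots> = (cos (x - d) - cos (x - d + 2 * real N * d)) / 2"
    by (subst sum_lessThan_telescope') simp
  also have "2 * real N * d = pi"
    using assms by (simp add: d_def)
  finally show ?thesis
    unfolding d d_def[symmetric] by simp
qed

lemma sum_cos_half_circle:
  fixes x :: real
  assumes "N > 0"
  shows "(\<Sum>m<N. cos (x + pi * real m / real N)) * sin (pi / (2 * real N)) = - sin (x - pi / (2 * real N))"
proof -
  have "sin (x + pi/2 + pi * real m / real N) = cos (x + pi * real m / real N)" for m
    by (simp add: sin_cos_eq [of "x + pi/2 + pi * real m / real N"] cos_minus [of "x + pi * real m / real N", symmetric])
  moreover have "cos (x + pi/2 - pi / (2 * real N)) = - sin (x - pi / (2 * real N))"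
    using minus_sin_cos_eq[of "x - pi / (2 * real N)"] by (simp add: algebra_simps)
  ultimately show ?thesis
    using sum_sin_half_circle[OF assms, of "x + pi/2"] by simp
qed

section \<open>Periodic sequences\<close>

lemma periodic_eq_mod:
  fixes f :: "nat \<Rightarrow> 'a"
  assumes "\<And>n. f (n + T) = f n"
  shows "f n = f (n mod T)"
proof -
  have "f (m + k * T) = f m" for m k
    by (induction k) (simp_all add: assms add.assoc[symmetric] add.commute[of T])
  from this[of "n mod T" "n div T"] show ?thesis
    by simp
qed

lemma int_periodic_eq_mod:
  fixes f :: "int \<Rightarrow> 'a"
  assumes "\<And>n. f (n + T) = f n"
  shows "f n = f (n mod T)"
proof -
  have pos: "f (m + int k * T) = f m" for m k
  proof (induction k)
    case (Suc k)
    then show ?case using assms[of "m + int k * T"] by (simp add: algebra_simps)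
  qed simp
  have "f (m + k * T) = f m" for m k
  proof (cases "k \<ge> 0")
    case True
    then show ?thesis using pos[of m "nat k"] by simp
  next
    case False
    then show ?thesis using pos[of "m + k * T" "nat (- k)"] by simp
  qed
  from this[of "n mod T" "n div T"] show ?thesis
    by simp
qed

text \<open>
  A stride coprime to the period visits every residue class once. This reduces sums along the rotation
  by \<open>p / Q\<close> to sums over equally spaced points.
\<close>

lemma sum_periodic_coprime_stride:
  fixes f :: "int \<Rightarrow> 'a::comm_monoid_add"
  assumes per: "\<And>m. f (m + int Q) = f m" and "Q > 0" and "coprime p (int Q)"
  shows "(\<Sum>j<Q. f (int j * p + r)) = (\<Sum>j<Q. f (int j))"
proof -
  define \<sigma> where "\<sigma> j = nat ((int j * p + r) mod int Q)" for j
  have \<sigma>: "int (\<sigma> j) = (int j * p + r) mod int Q" for j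
    using \<open>Q > 0\<close> by (simp add: \<sigma>_def)
  have "inj_on \<sigma> {..<Q}"
  proof (rule inj_onI)
    fix i j assume ij: "i \<in> {..<Q}" "j \<in> {..<Q}" and eq: "\<sigma> i = \<sigma> j"
    have "(int i * p + r) mod int Q = (int j * p + r) mod int Q"
      using eq \<sigma> by metis
    then have "int Q dvd (int i - int j) * p"
      by (simp add: mod_eq_dvd_iff algebra_simps)
    then have "int Q dvd int i - int j"
      using \<open>coprime p (int Q)\<close> by (simp add: coprime_dvd_mult_left_iff coprime_commute)
    then have "int i mod int Q = int j mod int Q"
      by (simp add: mod_eq_dvd_iff)
    then show "i = j" using ij by simp
  qed
  moreover have "\<sigma> ` {..<Q} \<subseteq> {..<Q}"
    using \<open>Q > 0\<close> by (auto simp: \<sigma>_def nat_less_iff)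
  ultimately have "bij_betw \<sigma> {..<Q} {..<Q}"
    by (simp add: bij_betw_def endo_inj_surj)
  then have "(\<Sum>j<Q. f (int (\<sigma> j))) = (\<Sum>j<Q. f (int j))"
    by (rule sum.reindex_bij_betw)
  moreover have "f (int (\<sigma> j)) = f (int j * p + r)" for j
    using int_periodic_eq_mod[of f "int Q", OF per, of "int j * p + r"] \<sigma> by simp
  ultimately show ?thesis by simp
qed

lemma periodic_range_finite:
  fixes f :: "nat \<Rightarrow> 'a"
  assumes "T > 0" "\<And>n. f (n + T) = f n"
  shows "finite (range f)"
proof -
  have "range f \<subseteq> f ` {..<T}"
    using periodic_eq_mod[of f T, OF assms(2)] \<open>T > 0\<close>
    by (metis image_subsetI imageI lessThan_iff mod_less_divisor)
  then show ?thesis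
    by (rule finite_subset) auto
qed

lemma periodic_partial_sums_bounded:
  fixes g :: "nat \<Rightarrow> real"
  assumes "T > 0" "\<And>n. g (n + T) = g n" "(\<Sum>n<T. g n) = 0"
  shows "\<exists>B. \<forall>n. \<bar>\<Sum>j<n. g j\<bar> \<le> B"
proof -
  define G where "G n = (\<Sum>j<n. g j)" for n
  have "G (n + T) = G n" for n
    by (induction n) (use assms in \<open>auto simp: G_def\<close>)
  then have "finite (range G)"
    using periodic_range_finite \<open>T > 0\<close> by blast
  then have "bounded (range G)"
    by (rule finite_imp_bounded)
  then show ?thesis
    by (auto simp: bounded_iff G_def)
qed

section \<open>The mean of the absolute sine along an irrational rotation\<close>

lemma sin_add_int_pi_abs: "\<bar>sin (x + pi * of_int m)\<bar> = \<bar>sin x\<bar>"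
proof -
  have "(cos (pi * real_of_int m))\<^sup>2 = 1"
    using sin_cos_squared_add[of "pi * real_of_int m"] by (simp add: mult.commute sin_integer_2pi)
  then have "\<bar>cos (pi * real_of_int m)\<bar> = 1"
    by (metis abs_1 real_sqrt_abs real_sqrt_one)
  then show ?thesis
    by (simp add: sin_add abs_mult sin_integer_2pi sin_zero_iff_int2 mult.commute)
qed

text \<open>
  Modulo \<open>pi\<close> the points are equally spaced with distance \<open>pi / Q\<close>, so they can be relabelled to start
  at some \<open>y\<close> in \<open>[0, pi / Q)\<close>. Then all sines are nonnegative and the closed form
  \<open>cos (y - pi / (2 * Q)) / sin (pi / (2 * Q))\<close> applies, which is smallest at \<open>y = 0\<close>.
\<close>

lemma sum_abs_sin_ge_cot:
  assumes "Q > 0" "coprime p (int Q)"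
  shows "(\<Sum>j<Q. \<bar>sin (x + pi * of_int (int j * p) / real Q)\<bar>) \<ge> cot (pi / (2 * real Q))"
proof -
  define r where "r = \<lfloor>x * real Q / pi\<rfloor>"
  define y where "y = x - pi * of_int r / real Q"
  have y: "0 \<le> y" "y < pi / real Q"
  proof -
    have "of_int r \<le> x * real Q / pi" "x * real Q / pi < of_int r + 1"
      by (auto simp: r_def)
    then have "of_int r * pi \<le> x * real Q" "x * real Q < of_int r * pi + pi"
      by (auto simp: field_simps)
    then show "0 \<le> y" "y < pi / real Q"
      using \<open>Q > 0\<close> by (auto simp: y_def divide_simps) (auto simp: algebra_simps)
  qed
  define f where "f m = \<bar>sin (y + pi * of_int m / real Q)\<bar>" for m :: int
  have per: "f (m + int Q) = f m" for m
    using \<open>Q > 0\<close> sin_add_int_pi_abs[of "y + pi * of_int m / real Q" 1]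
    by (simp add: f_def add_divide_distrib distrib_left add.assoc)
  have "\<bar>sin (x + pi * of_int (int j * p) / real Q)\<bar> = f (int j * p + r)" for j
    by (simp add: f_def y_def add_divide_distrib distrib_left algebra_simps)
  then have "(\<Sum>j<Q. \<bar>sin (x + pi * of_int (int j * p) / real Q)\<bar>) = (\<Sum>j<Q. f (int j))"
    using sum_periodic_coprime_stride[of f Q p r, OF per assms] by simp
  also have "\<dots> = (\<Sum>j<Q. sin (y + pi * real j / real Q))"
  proof (intro sum.cong refl)
    fix j assume "j \<in> {..<Q}"
    then have "real j + 1 \<le> real Q" by auto
    then have "pi * (real j + 1) / real Q \<le> pi * real Q / real Q"
      by (intro divide_right_mono mult_left_mono) auto
    then have "pi * (real j + 1) / real Q \<le> pi"
      using \<open>Q > 0\<close> by simp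
    then have "y + pi * real j / real Q \<le> pi"
      using y by (simp add: add_divide_distrib distrib_left)
    moreover have "0 \<le> y + pi * real j / real Q"
      using y by simp
    ultimately show "f (int j) = sin (y + pi * real j / real Q)"
      by (simp add: f_def sin_ge_zero)
  qed
  also have "\<dots> = cos (y - pi / (2 * real Q)) / sin (pi / (2 * real Q))"
  proof -
    have "pi / (2 * real Q) < pi"
      using \<open>Q > 0\<close> by (simp add: field_simps)
    then have "sin (pi / (2 * real Q)) > 0"
      using \<open>Q > 0\<close> by (intro sin_gt_zero) auto
    then show ?thesis
      using sum_sin_half_circle[OF \<open>Q > 0\<close>, of y] by (simp add: field_simps)
  qed
  also have "\<dots> \<ge> cos (pi / (2 * real Q)) / sin (pi / (2 * real Q))"
  proof (rule divide_right_mono)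
    have "\<bar>y - pi / (2 * real Q)\<bar> \<le> pi / (2 * real Q)"
      using y by (simp add: abs_le_iff field_simps)
    moreover have "pi / (2 * real Q) \<le> pi"
      using \<open>Q > 0\<close> by (simp add: field_simps)
    ultimately have "cos (pi / (2 * real Q)) \<le> cos \<bar>y - pi / (2 * real Q)\<bar>"
      by (intro cos_monotone_0_pi_le) auto
    then show "cos (pi / (2 * real Q)) \<le> cos (y - pi / (2 * real Q))"
      by simp
    have "pi / (2 * real Q) \<le> pi"
      using \<open>Q > 0\<close> by (simp add: field_simps)
    then show "0 \<le> sin (pi / (2 * real Q))"
      by (intro sin_ge_zero) auto
  qed
  finally show ?thesis
    by (simp add: cot_def)
qed

lemma abs_sin_diff_le: "\<bar>sin x - sin y\<bar> \<le> \<bar>x - y :: real\<bar>"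
proof -
  have "\<bar>sin x - sin y\<bar> = 2 * \<bar>sin ((x - y) / 2)\<bar> * \<bar>cos ((x + y) / 2)\<bar>"
    by (simp add: sin_diff_sin abs_mult)
  also have "\<dots> \<le> 2 * \<bar>(x - y) / 2\<bar> * 1"
    by (intro mult_mono mult_left_mono abs_sin_x_le_abs_x) auto
  finally show ?thesis by simp
qed

text \<open>
  The bound is uniform in the starting point \<open>x\<close>. Take a Dirichlet approximation \<open>h / Q\<close> of \<open>k\<close> with
  error below \<open>1 / Q\<^sup>2\<close>: over \<open>Q\<close> steps the rotation by \<open>k\<close> stays within \<open>pi / Q\<close> of the rotation by
  \<open>h / Q\<close>, so the sums differ by at most \<open>pi\<close>, while \<open>cot (pi / (2 * Q))\<close> grows like \<open>2 * Q / pi\<close>.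
  Irrationality of \<open>k\<close> provides arbitrarily large \<open>Q\<close>.
\<close>

lemma cesaro_abs_sin_irrational:
  fixes k \<mu> :: real
  assumes "k \<notin> \<rat>" and "\<mu> < 2 / pi"
  shows "\<exists>L>0. \<forall>x. \<mu> * real L \<le> (\<Sum>j<L. \<bar>sin (x + pi * k * real j)\<bar>)"
proof -
  have "(\<lambda>Q. (cot (pi / (2 * real Q)) - pi) / real Q) \<longlonglongrightarrow> 2 / pi"
    unfolding cot_def by real_asymp
  then have "\<forall>\<^sub>F Q in sequentially. \<mu> < (cot (pi / (2 * real Q)) - pi) / real Q"
    using assms(2) by (rule order_tendstoD(1))
  then obtain Q0 where Q0: "\<And>Q. Q \<ge> Q0 \<Longrightarrow> \<mu> < (cot (pi / (2 * real Q)) - pi) / real Q"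
    by (auto simp: eventually_sequentially)
  have "infinite (approx_set k)"
    using assms(1) rational_iff_finite_approx_set by blast
  then obtain h K where hK: "(h, K) \<in> approx_set k" "K > int Q0"
    using infinite_approx_set by blast
  define Q where "Q = nat K"
  have K: "K = int Q" and "Q > 0" "Q \<ge> Q0"
    using hK by (auto simp: Q_def)
  have cop: "coprime h (int Q)" and app: "\<bar>k - of_int h / real Q\<bar> < 1 / (real Q)\<^sup>2"
    using hK(1) by (auto simp: approx_set_def K)
  have "\<mu> * real Q \<le> (\<Sum>j<Q. \<bar>sin (x + pi * k * real j)\<bar>)" for x
  proof -
    have "\<bar>sin (x + pi * of_int (int j * h) / real Q)\<bar> - pi / real Q \<le> \<bar>sin (x + pi * k * real j)\<bar>"
      if "j < Q" for j
    proof -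
      have "\<bar>sin (x + pi * of_int (int j * h) / real Q) - sin (x + pi * k * real j)\<bar>
          \<le> \<bar>pi * real j * (of_int h / real Q - k)\<bar>"
        using abs_sin_diff_le[of "x + pi * of_int (int j * h) / real Q" "x + pi * k * real j"]
        by (simp add: algebra_simps)
      also have "\<dots> = pi * real j * \<bar>k - of_int h / real Q\<bar>"
        by (simp add: abs_mult abs_minus_commute)
      also have "\<dots> \<le> pi * real Q * (1 / (real Q)\<^sup>2)"
        using app that by (intro mult_mono mult_left_mono) auto
      also have "\<dots> = pi / real Q"
        by (simp add: power2_eq_square)
      finally show ?thesis by linarith
    qed
    then have "(\<Sum>j<Q. \<bar>sin (x + pi * of_int (int j * h) / real Q)\<bar> - pi / real Q)
        \<le> (\<Sum>j<Q. \<bar>sin (x + pi * k * real j)\<bar>)"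
      by (intro sum_mono) auto
    then have "cot (pi / (2 * real Q)) - pi \<le> (\<Sum>j<Q. \<bar>sin (x + pi * k * real j)\<bar>)"
      using sum_abs_sin_ge_cot[OF \<open>Q > 0\<close> cop, of x] \<open>Q > 0\<close> by (simp add: sum_subtractf)
    moreover have "\<mu> * real Q < cot (pi / (2 * real Q)) - pi"
      using Q0[OF \<open>Q \<ge> Q0\<close>] \<open>Q > 0\<close> by (simp add: field_simps)
    ultimately show ?thesis by simp
  qed
  then show ?thesis using \<open>Q > 0\<close> by blast
qed





section \<open>Solutions of Wigner--von Neumann type\<close>

text \<open>
  The potential that makes \<open>u\<close> a solution is \<open>E - (u (n + 1) + u (n - 1)) / u n\<close>. Expanding
  \<open>(n + 1) powr - \<kappa>\<close> and \<open>(n - 1) powr - \<kappa>\<close> in powers of \<open>1 / n\<close>, the terms of order \<open>1\<close> cancel because \<open>\<alpha>\<close>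
  is a free solution; at order \<open>1 / n\<close> the loss of amplitude contributes
  \<open>- \<kappa> * (\<alpha> (n + 1) - \<alpha> (n - 1))\<close>, and the equation \<open>forced\<close> for the correction \<open>\<beta>\<close> is the one that turns
  this into the prescribed \<open>- a * s n * \<alpha> n\<close>. The lower bound on \<open>\<bar>\<alpha>\<bar>\<close> controls the division by \<open>u n\<close>.
\<close>

lemma wigner_von_neumann_ansatz:
  fixes \<alpha> \<beta> s :: "nat \<Rightarrow> real" and E a \<kappa> \<delta> :: real
  assumes free: "\<And>n. \<alpha> (Suc (Suc n)) + \<alpha> n = E * \<alpha> (Suc n)"
    and forced: "\<And>n. \<beta> (Suc (Suc n)) + \<beta> n - E * \<beta> (Suc n)
                  = \<kappa> * (\<alpha> (Suc (Suc n)) - \<alpha> n) - a * s (Suc n) * \<alpha> (Suc n)"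
    and "Bseq \<alpha>" "Bseq \<beta>" "Bseq s" and "\<delta> > 0" and away: "\<And>n. \<delta> \<le> \<bar>\<alpha> n\<bar>"
  defines "u \<equiv> \<lambda>n. real n powr - \<kappa> * (\<alpha> n + \<beta> n / real n)"
  shows "\<forall>\<^sub>F n in sequentially. u n \<noteq> 0"
    and "(\<lambda>n. real n * (E - (u (n + 1) + u (n - 1)) / u n) - a * s n) \<longlonglongrightarrow> 0"
proof -
  have null: "(\<lambda>n. f n * g n) \<longlonglongrightarrow> 0" if "f \<longlonglongrightarrow> 0" "Bseq g" for f g :: "nat \<Rightarrow> real"
    using bounded_bilinear.Zfun_prod_Bfun[OF bounded_bilinear_mult, of f sequentially g] that
    by (simp add: tendsto_Zfun_iff)
  define v where "v n = \<alpha> n + \<beta> n / real n" for n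
  \<comment> \<open>The four coefficients in the remainder of the expansion, normalised to tend to \<open>0\<close>.\<close>
  define A where "A = (\<lambda>n. real n * ((1 + 1 / real n) powr - \<kappa> - 1) + \<kappa>)"
  define B where "B = (\<lambda>n. real n * ((1 - 1 / real n) powr - \<kappa> - 1) - \<kappa>)"
  define C where "C = (\<lambda>n. real n / (real n + 1) * (1 + 1 / real n) powr - \<kappa> - 1)"
  define D where "D = (\<lambda>n. real n / (real n - 1) * (1 - 1 / real n) powr - \<kappa> - 1)"
  have lims: "A \<longlonglongrightarrow> 0" "B \<longlonglongrightarrow> 0" "C \<longlonglongrightarrow> 0" "D \<longlonglongrightarrow> 0"
    unfolding A_def B_def C_def D_def by real_asymp+
  have BSuc: "Bseq (\<lambda>n. f (n + 1))" "Bseq (\<lambda>n. f (n - 1))" if "Bseq f" for f :: "nat \<Rightarrow> real"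
    using that by (auto simp: Bseq_def)
  define \<rho> where "\<rho> n = A n * \<alpha> (n + 1) + B n * \<alpha> (n - 1) + C n * \<beta> (n + 1) + D n * \<beta> (n - 1)" for n
  have \<rho>: "\<rho> \<longlonglongrightarrow> 0"
    unfolding \<rho>_def using null lims BSuc assms(3,4) by (auto intro!: tendsto_add_zero)
  have \<beta>n: "(\<lambda>n. \<beta> n / real n) \<longlonglongrightarrow> 0"
    using null[OF lim_inverse_n \<open>Bseq \<beta>\<close>] by (simp add: field_simps)
  have v_away: "\<forall>\<^sub>F n in sequentially. \<delta> / 2 < \<bar>v n\<bar>"
  proof -
    have "\<forall>\<^sub>F n in sequentially. \<bar>\<beta> n / real n\<bar> < \<delta> / 2"
      using tendstoD[OF \<beta>n, of "\<delta> / 2"] \<open>\<delta> > 0\<close> by simp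
    then show ?thesis
    proof eventually_elim
      case (elim n)
      then show ?case using away[of n] unfolding v_def by linarith
    qed
  qed
  show "\<forall>\<^sub>F n in sequentially. u n \<noteq> 0"
    using v_away eventually_gt_at_top[of 0]
    by eventually_elim (use \<open>\<delta> > 0\<close> in \<open>auto simp: u_def v_def\<close>)
  have resid: "real n * (E - (u (n + 1) + u (n - 1)) / u n) * v n = a * s n * \<alpha> n - \<rho> n"
    if n: "n \<ge> 2" and "v n \<noteq> 0" for n
  proof -
    define X where "X = (1 + 1 / real n) powr - \<kappa>"
    define Y where "Y = (1 - 1 / real n) powr - \<kappa>"
    define Z where "Z = real n powr - \<kappa>"
    have Z: "Z > 0" using n by (simp add: Z_def)
    have "real (n + 1) = real n * (1 + 1 / real n)" "real (n - 1) = real n * (1 - 1 / real n)"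
      using n by (auto simp: field_simps of_nat_diff)
    then have up: "u (n + 1) = Z * X * v (n + 1)" "u (n - 1) = Z * Y * v (n - 1)"
      using n by (simp_all only: u_def v_def Z_def X_def Y_def powr_mult)
    have u: "u n = Z * v n"
      by (simp add: u_def v_def Z_def)
    have ratio: "(u (n + 1) + u (n - 1)) / u n = (X * v (n + 1) + Y * v (n - 1)) / v n"
      using Z \<open>v n \<noteq> 0\<close> unfolding up u by (simp add: field_simps)
    have 1: "real n * (E - (u (n + 1) + u (n - 1)) / u n) * v n
        = real n * (E * v n - X * v (n + 1) - Y * v (n - 1))"
      unfolding ratio using \<open>v n \<noteq> 0\<close> by (simp add: field_simps)
    have nv: "real n * v n = real n * \<alpha> n + \<beta> n"
      using n by (simp add: v_def field_simps)
    have nv1: "real n * (X * v (n + 1)) = (A n - \<kappa> + real n) * \<alpha> (n + 1) + (C n + 1) * \<beta> (n + 1)"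
      using n by (simp add: A_def C_def X_def v_def divide_simps) (simp add: algebra_simps)
    have nv2: "real n * (Y * v (n - 1)) = (B n + \<kappa> + real n) * \<alpha> (n - 1) + (D n + 1) * \<beta> (n - 1)"
      using n by (simp add: B_def D_def Y_def v_def divide_simps of_nat_diff) (simp add: algebra_simps)
    have f: "\<alpha> (n + 1) + \<alpha> (n - 1) = E * \<alpha> n"
      "\<beta> (n + 1) + \<beta> (n - 1) - E * \<beta> n = \<kappa> * (\<alpha> (n + 1) - \<alpha> (n - 1)) - a * s n * \<alpha> n"
      using free[of "n - 1"] forced[of "n - 1"] n by simp_all
    have "real n * (E * v n - X * v (n + 1) - Y * v (n - 1))
        = E * (real n * v n) - real n * (X * v (n + 1)) - real n * (Y * v (n - 1))"
      by (simp add: algebra_simps)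
    also have "\<dots> = real n * (E * \<alpha> n - \<alpha> (n + 1) - \<alpha> (n - 1)) 
         - (\<beta> (n + 1) + \<beta> (n - 1) - E * \<beta> n) + \<kappa> * (\<alpha> (n + 1) - \<alpha> (n - 1)) - \<rho> n"
      unfolding nv nv1 nv2 \<rho>_def by (simp add: algebra_simps)
    also have "\<dots> = a * s n * \<alpha> n - \<rho> n"
      using f by (simp add: algebra_simps)
    finally show ?thesis using 1 by simp
  qed
  have "(\<lambda>n. - \<rho> n - a * s n * (\<beta> n / real n)) \<longlonglongrightarrow> 0"
  proof -
    have "(\<lambda>n. a * ((\<beta> n / real n) * s n)) \<longlonglongrightarrow> 0"
      by (rule tendsto_mult_right_zero[OF null[OF \<beta>n \<open>Bseq s\<close>]])
    from tendsto_diff[OF tendsto_minus[OF \<rho>] this] show ?thesis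
      by (simp add: mult_ac)
  qed
  moreover have "Bseq (\<lambda>n. inverse (v n))"
  proof (rule BfunI)
    show "\<forall>\<^sub>F n in sequentially. norm (inverse (v n)) \<le> inverse (\<delta> / 2)"
      using v_away
    proof eventually_elim
      case (elim n)
      then show ?case
        using \<open>\<delta> > 0\<close> le_imp_inverse_le[of "\<delta> / 2" "\<bar>v n\<bar>"] by simp
    qed
  qed
  ultimately have lim: "(\<lambda>n. (- \<rho> n - a * s n * (\<beta> n / real n)) * inverse (v n)) \<longlonglongrightarrow> 0"
    by (rule null)
  have "\<forall>\<^sub>F n in sequentially. (- \<rho> n - a * s n * (\<beta> n / real n)) * inverse (v n)
      = real n * (E - (u (n + 1) + u (n - 1)) / u n) - a * s n"
    using v_away eventually_ge_at_top[of 2]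
  proof eventually_elim
    case (elim n)
    then have "v n \<noteq> 0" using \<open>\<delta> > 0\<close> by auto
    have "- \<rho> n - a * s n * (\<beta> n / real n) = a * s n * \<alpha> n - \<rho> n - a * s n * v n"
      by (simp add: v_def algebra_simps)
    also have "\<dots> = (real n * (E - (u (n + 1) + u (n - 1)) / u n) - a * s n) * v n"
      using resid[OF elim(2) \<open>v n \<noteq> 0\<close>] by (simp add: algebra_simps)
    finally show ?case using \<open>v n \<noteq> 0\<close> by simp
  qed
  then show "(\<lambda>n. real n * (E - (u (n + 1) + u (n - 1)) / u n) - a * s n) \<longlonglongrightarrow> 0"
    using lim by (simp add: tendsto_cong)
qed

text \<open>
  Variation of constants: the forced oscillator has a solution built from the partial sums of
  \<open>f j * cos\<close> and \<open>f j * sin\<close>, so it is bounded as soon as the forcing has no resonant component.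
\<close>

lemma forced_oscillator_bounded:
  fixes \<psi> \<eta> :: real and f :: "nat \<Rightarrow> real"
  assumes "sin \<eta> \<noteq> 0"
    and "\<forall>n. \<bar>\<Sum>j<n. f j * cos (\<psi> + real j * \<eta>)\<bar> \<le> B1"
    and "\<forall>n. \<bar>\<Sum>j<n. f j * sin (\<psi> + real j * \<eta>)\<bar> \<le> B2"
  obtains \<beta> where "Bseq \<beta>"
    "\<And>n. \<beta> (Suc (Suc n)) + \<beta> n - 2 * cos \<eta> * \<beta> (Suc n) = f (Suc n)"
proof
  define C where "C n = (\<Sum>j<n. f j * cos (\<psi> + real j * \<eta>))" for n
  define D where "D n = (\<Sum>j<n. f j * sin (\<psi> + real j * \<eta>))" for n
  define \<beta> where "\<beta> n = (sin (\<psi> + real n * \<eta>) * C n - cos (\<psi> + real n * \<eta>) * D n) / sin \<eta>" for n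
  show "Bseq \<beta>"
  proof (rule BseqI')
    fix n
    have "\<bar>sin (\<psi> + real n * \<eta>) * C n - cos (\<psi> + real n * \<eta>) * D n\<bar> \<le> 1 * \<bar>C n\<bar> + 1 * \<bar>D n\<bar>"
      unfolding abs_mult[symmetric]
      by (rule order_trans[OF abs_triangle_ineq4], unfold abs_mult, intro add_mono mult_right_mono) auto
    also have "\<dots> \<le> B1 + B2"
      using assms(2,3) by (auto simp: C_def D_def intro!: add_mono)
    finally show "norm (\<beta> n) \<le> (B1 + B2) / \<bar>sin \<eta>\<bar>"
      by (simp add: \<beta>_def divide_right_mono)
  qed
  fix n
  define x where "x = \<psi> + real (Suc n) * \<eta>"
  define g where "g = f (Suc n)"
  have x: "\<psi> + real n * \<eta> = x - \<eta>" "\<psi> + real (Suc n) * \<eta> = x" "\<psi> + real (Suc (Suc n)) * \<eta> = x + \<eta>"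
    by (simp_all add: x_def algebra_simps)
  have Suc: "C (Suc (Suc n)) = C n + f n * cos (x - \<eta>) + g * cos x" "C (Suc n) = C n + f n * cos (x - \<eta>)"
    "D (Suc (Suc n)) = D n + f n * sin (x - \<eta>) + g * sin x" "D (Suc n) = D n + f n * sin (x - \<eta>)"
    unfolding C_def D_def g_def sum.lessThan_Suc x by simp_all
  define c d where "c = C n + f n * cos (x - \<eta>)" and "d = D n + f n * sin (x - \<eta>)"
  have n0: "sin (x - \<eta>) * C n - cos (x - \<eta>) * D n = sin (x - \<eta>) * c - cos (x - \<eta>) * d"
    by (simp add: c_def d_def algebra_simps)
  have free: "sin (x + \<eta>) + sin (x - \<eta>) = 2 * cos \<eta> * sin x" "cos (x + \<eta>) + cos (x - \<eta>) = 2 * cos \<eta> * cos x"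
    by (simp_all add: sin_add sin_diff cos_add cos_diff)
  have \<beta>: "\<beta> m * sin \<eta> = sin (\<psi> + real m * \<eta>) * C m - cos (\<psi> + real m * \<eta>) * D m" for m
    using assms(1) by (simp add: \<beta>_def)
  have "(\<beta> (Suc (Suc n)) + \<beta> n - 2 * cos \<eta> * \<beta> (Suc n)) * sin \<eta>
      = \<beta> (Suc (Suc n)) * sin \<eta> + \<beta> n * sin \<eta> - 2 * cos \<eta> * (\<beta> (Suc n) * sin \<eta>)"
    by (simp add: algebra_simps)
  also have "\<dots>
      = (sin (x + \<eta>) * (c + g * cos x) - cos (x + \<eta>) * (d + g * sin x))
        + (sin (x - \<eta>) * c - cos (x - \<eta>) * d) - 2 * cos \<eta> * (sin x * c - cos x * d)"
    unfolding \<beta> x Suc n0 c_def[symmetric] d_def[symmetric] by simp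
  also have "\<dots> = (sin (x + \<eta>) + sin (x - \<eta>) - 2 * cos \<eta> * sin x) * c
      - (cos (x + \<eta>) + cos (x - \<eta>) - 2 * cos \<eta> * cos x) * d
      + g * (sin (x + \<eta>) * cos x - cos (x + \<eta>) * sin x)"
    by (simp add: algebra_simps)
  also have "\<dots> = g * sin \<eta>"
    using sin_diff[of "x + \<eta>" x] by (simp add: free)
  finally show "\<beta> (Suc (Suc n)) + \<beta> n - 2 * cos \<eta> * \<beta> (Suc n) = f (Suc n)"
    using assms(1) by (simp add: g_def)
qed





section \<open>From real solutions to eigenvalues\<close>

lemma is_eigenvalueI_real:
  fixes u V :: "nat \<Rightarrow> real"
  assumes "u 0 = cos \<theta>" "u 1 = sin \<theta>"
    and eq: "\<And>n. n \<ge> 1 \<Longrightarrow> u (n + 1) + u (n - 1) + V n * u n = E * u n"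
    and sum: "summable (\<lambda>n. (u n)\<^sup>2)"
  shows "is_eigenvalue V \<theta> E"
  unfolding is_eigenvalue_def
proof (intro exI conjI allI impI)
  let ?u = "\<lambda>n. complex_of_real (u n)"
  show "?u \<noteq> (\<lambda>_. 0)"
  proof
    assume "?u = (\<lambda>_. 0)"
    then have "?u 0 = 0" "?u 1 = 0" by meson+
    then show False
      using assms(1,2) sin_cos_squared_add[of \<theta>] by simp
  qed
  show "schroedinger_op V ?u n = of_real E * ?u n" if "n \<ge> 1" for n
    using arg_cong[OF eq[OF that], of complex_of_real] by (simp add: schroedinger_op_def)
  show "boundary_condition \<theta> ?u"
    using assms(1,2) by (simp add: boundary_condition_def)
  have "summable (\<lambda>n. norm ((cmod (?u n))\<^sup>2))"
    using sum by simp
  then have "(\<lambda>n. (cmod (?u n))\<^sup>2) summable_on UNIV"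
    by (rule norm_summable_imp_summable_on)
  then show "square_summable ?u"
    unfolding square_summable_def by (rule summable_on_subset_banach) simp
qed

fun free_solution :: "real \<Rightarrow> real \<Rightarrow> real \<Rightarrow> nat \<Rightarrow> real" where
  "free_solution E x y 0 = x"
| "free_solution E x y (Suc 0) = y"
| "free_solution E x y (Suc (Suc n)) = E * free_solution E x y (Suc n) - free_solution E x y n"

lemma free_solution_not_both_zero:
  assumes "x \<noteq> 0 \<or> y \<noteq> 0"
  shows "free_solution E x y n \<noteq> 0 \<or> free_solution E x y (Suc n) \<noteq> 0"
  using assms by (induction n) auto

text \<open>
  Follow the free solution with the given initial values up to an index \<open>M\<close> with \<open>u M \<noteq> 0\<close>, which
  exists because a free solution has no two consecutive zeros, and continue with \<open>t\<close>. From \<open>M\<close> on all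
  values of \<open>u\<close> are nonzero, so the equation can be solved for \<open>V n\<close>.
\<close>

lemma prescribed_tail:
  fixes t :: "nat \<Rightarrow> real"
  assumes "\<forall>\<^sub>F n in sequentially. t n \<noteq> 0" and "x \<noteq> 0 \<or> y \<noteq> 0"
  obtains u V :: "nat \<Rightarrow> real" where "u 0 = x" "u 1 = y"
    "\<And>n. n \<ge> 1 \<Longrightarrow> u (n + 1) + u (n - 1) + V n * u n = E * u n"
    "\<forall>\<^sub>F n in sequentially. u n = t n"
    "\<forall>\<^sub>F n in sequentially. V n = E - (t (n + 1) + t (n - 1)) / t n"
proof -
  obtain N where N: "\<And>n. n \<ge> N \<Longrightarrow> t n \<noteq> 0"
    using assms(1) by (auto simp: eventually_sequentially)
  let ?v = "free_solution E x y"
  obtain M where M: "M \<ge> max N 1" "?v M \<noteq> 0"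
    using free_solution_not_both_zero[OF assms(2), of E "max N 1"] by (metis le_SucI order_refl)
  define u where "u n = (if n \<le> M then ?v n else t n)" for n
  define V where "V n = (if n < M then 0 else E - (u (n + 1) + u (n - 1)) / u n)" for n
  show thesis
  proof
    show "u 0 = x" "u 1 = y"
      using M by (simp_all add: u_def)
    show "u (n + 1) + u (n - 1) + V n * u n = E * u n" if "n \<ge> 1" for n
    proof (cases "n < M")
      case True
      then show ?thesis using that by (cases n) (simp_all add: u_def V_def)
    next
      case False
      then have "u n \<noteq> 0" using M N[of n] by (cases "n = M") (auto simp: u_def)
      then show ?thesis using False by (simp add: V_def field_simps)
    qed
    show "\<forall>\<^sub>F n in sequentially. u n = t n"
      using eventually_gt_at_top[of M] by eventually_elim (simp add: u_def)
    show "\<forall>\<^sub>F n in sequentially. V n = E - (t (n + 1) + t (n - 1)) / t n"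
      using eventually_gt_at_top[of "Suc M"] by eventually_elim (auto simp: u_def V_def)
  qed
qed

section \<open>Rational energies with even denominator\<close>

text \<open>
  The two sums pair the forcing \<open>f\<close> in \<open>wigner_von_neumann_ansatz\<close> with the free solutions. Their
  terms have period \<open>q\<close>, so it suffices that they vanish over one period. The offset
  \<open>pi / (2 * q)\<close> in \<open>\<psi>\<close> places the doubled phases in the optimal position, symmetric about the real axis
  and away from it. Shifting \<open>n\<close> by \<open>q div 2\<close> moves the doubled phase by an odd multiple of \<open>pi\<close>.
  Hence in the sine sum the terms linear in \<open>sin (2 * \<psi> n)\<close> and in its sign cancel, leaving the cosines
  over a half circle, whose sum is \<open>0\<close> by symmetry. The cosine sum expresses the balance between the loss
  of amplitude and the mean of \<open>\<bar>sin\<bar>\<close>, and it vanishes for exactly the value of \<open>\<kappa>\<close> assumed here.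
\<close>

lemma resonant_periodic_sums:
  fixes p q :: nat and a \<eta> \<kappa> :: real
  assumes q: "even q" "q > 0" and "coprime p q" and \<eta>: "\<eta> = pi * real p / real q"
    and \<kappa>: "\<kappa> * sin \<eta> * (real q * sin (pi / real q)) = a"
  defines "\<psi> \<equiv> \<lambda>n. pi / (2 * real q) + real n * \<eta>"
  defines "f \<equiv> \<lambda>n. 2 * \<kappa> * sin \<eta> * cos (\<psi> n) - a * sgn (sin (2 * \<psi> n)) * sin (\<psi> n)"
  shows "\<exists>B. \<forall>n. \<bar>\<Sum>j<n. f j * cos (\<psi> j)\<bar> \<le> B" (is ?cos)
    and "\<exists>B. \<forall>n. \<bar>\<Sum>j<n. f j * sin (\<psi> j)\<bar> \<le> B" (is ?sin)
    and "\<exists>\<delta>>0. \<forall>n. \<delta> \<le> \<bar>sin (2 * \<psi> n)\<bar>"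
proof -
  obtain N where N: "q = 2 * N" "N > 0"
    using q by (auto elim: evenE)
  have "odd p" "coprime (int p) (int N)"
    using \<open>coprime p q\<close> N by (auto simp: coprime_mult_right_iff)
  \<comment> \<open>Doubled phases, indexed by the vertices that they visit; modulo \<open>pi\<close> there are only \<open>N\<close> of them.\<close>
  define y where "y m = pi / (2 * real N) + pi * of_int m / real N" for m :: int
  have y_shift: "y (m + int N) = y m + pi" for m
    using N by (simp add: y_def field_simps)
  have \<psi>y: "2 * \<psi> n = y (int n * int p + 0)" for n
    using N by (simp add: \<psi>_def y_def \<eta> field_simps)
  have \<psi>_shift: "2 * \<psi> (n + N) = 2 * \<psi> n + pi * real p" for n
    using N by (simp add: \<psi>_def \<eta> field_simps)
  have anti: "sin (2 * \<psi> (n + N)) = - sin (2 * \<psi> n)" "cos (2 * \<psi> (n + N)) = - cos (2 * \<psi> n)" for n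
    unfolding \<psi>_shift using \<open>odd p\<close> by (simp_all add: sin_add cos_add)
  have y_pos: "sin (y (int m)) > 0" if "m < N" for m
  proof (rule sin_gt_zero)
    show "0 < y (int m)" using N by (simp add: y_def add_pos_nonneg)
    have "y (int m) = pi * (2 * real m + 1) / (2 * real N)"
      using N by (simp add: y_def field_simps)
    also have "\<dots> < pi * (2 * real N) / (2 * real N)"
      using that N by (intro divide_strict_right_mono mult_strict_left_mono) auto
    also have "\<dots> = pi"
      using N by simp
    finally show "y (int m) < pi" .
  qed
  have sN: "sin (pi / (2 * real N)) > 0"
    using N by (intro sin_gt_zero) (auto simp: field_simps)
  have abs_sum: "(\<Sum>n<N. \<bar>sin (2 * \<psi> n)\<bar>) = 1 / sin (pi / (2 * real N))"
  proof -
    have "(\<Sum>n<N. \<bar>sin (2 * \<psi> n)\<bar>) = (\<Sum>m<N. \<bar>sin (y (int m))\<bar>)"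
      unfolding \<psi>y by (rule sum_periodic_coprime_stride[of "\<lambda>m. \<bar>sin (y m)\<bar>"])
        (use N \<open>coprime (int p) (int N)\<close> in \<open>simp_all add: y_shift\<close>)
    also have "\<dots> = (\<Sum>m<N. sin (y (int m)))"
      using y_pos by (intro sum.cong) (auto simp: less_imp_le)
    also have "\<dots> = 1 / sin (pi / (2 * real N))"
      using sum_sin_half_circle[OF \<open>N > 0\<close>, of "pi / (2 * real N)"] sN by (simp add: y_def field_simps)
    finally show ?thesis .
  qed
  have cos_sum: "(\<Sum>n<N. sgn (sin (2 * \<psi> n)) * cos (2 * \<psi> n)) = 0"
  proof -
    have "(\<Sum>n<N. sgn (sin (2 * \<psi> n)) * cos (2 * \<psi> n)) = (\<Sum>m<N. sgn (sin (y (int m))) * cos (y (int m)))"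
      unfolding \<psi>y by (rule sum_periodic_coprime_stride[of "\<lambda>m. sgn (sin (y m)) * cos (y m)"])
        (use N \<open>coprime (int p) (int N)\<close> in \<open>simp_all add: y_shift sgn_minus\<close>)
    also have "\<dots> = (\<Sum>m<N. cos (y (int m)))"
      using y_pos by (intro sum.cong) auto
    also have "\<dots> = 0"
      using sum_cos_half_circle[OF \<open>N > 0\<close>, of "pi / (2 * real N)"] sN by (simp add: y_def)
    finally show ?thesis .
  qed
  have half: "(\<Sum>n<q. g n) = (\<Sum>n<N. g n + g (n + N))" for g :: "nat \<Rightarrow> real"
  proof -
    have "(\<Sum>n<N + M. g n) = (\<Sum>n<N. g n) + (\<Sum>n<M. g (n + N))" for M
      by (induction M) (simp_all add: ac_simps)
    from this[of N] show ?thesis using N by (simp add: mult_2 sum.distrib)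
  qed
  have dbl: "(sin z)\<^sup>2 = (1 - cos (2 * z)) / 2" "(cos z)\<^sup>2 = (1 + cos (2 * z)) / 2" "sin z * cos z = sin (2 * z) / 2" for z :: real
    using cos_double_sin[of z] cos_double_cos[of z] sin_double[of z] by simp_all
  have fc: "f n * cos (\<psi> n) = \<kappa> * sin \<eta> * (1 + cos (2 * \<psi> n)) - a / 2 * \<bar>sin (2 * \<psi> n)\<bar>" for n
  proof -
    have "f n * cos (\<psi> n) = 2 * \<kappa> * sin \<eta> * (cos (\<psi> n))\<^sup>2 - a * sgn (sin (2 * \<psi> n)) * (sin (\<psi> n) * cos (\<psi> n))"
      by (simp add: f_def power2_eq_square algebra_simps)
    then show ?thesis unfolding dbl by (simp add: abs_sgn mult_ac)
  qed
  have fs: "f n * sin (\<psi> n) = \<kappa> * sin \<eta> * sin (2 * \<psi> n) - a / 2 * sgn (sin (2 * \<psi> n)) * (1 - cos (2 * \<psi> n))" for n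
  proof -
    have "f n * sin (\<psi> n) = 2 * \<kappa> * sin \<eta> * (sin (\<psi> n) * cos (\<psi> n)) - a * sgn (sin (2 * \<psi> n)) * (sin (\<psi> n))\<^sup>2"
      by (simp add: f_def power2_eq_square algebra_simps)
    then show ?thesis unfolding dbl by simp
  qed
  have full: "sin (2 * \<psi> (n + q)) = sin (2 * \<psi> n)" "cos (2 * \<psi> (n + q)) = cos (2 * \<psi> n)" for n
  proof -
    have "n + q = (n + N) + N" using N by simp
    then show "sin (2 * \<psi> (n + q)) = sin (2 * \<psi> n)" "cos (2 * \<psi> (n + q)) = cos (2 * \<psi> n)"
      by (simp_all only: anti minus_minus)
  qed
  show ?cos
  proof (rule periodic_partial_sums_bounded[OF \<open>q > 0\<close>])
    show "f (n + q) * cos (\<psi> (n + q)) = f n * cos (\<psi> n)" for n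
      unfolding fc full ..
    have "(\<Sum>n<q. f n * cos (\<psi> n)) = (\<Sum>n<N. 2 * \<kappa> * sin \<eta> - a * \<bar>sin (2 * \<psi> n)\<bar>)"
      unfolding half fc anti by (simp add: algebra_simps)
    also have "\<dots> = 2 * real N * \<kappa> * sin \<eta> - a * (\<Sum>n<N. \<bar>sin (2 * \<psi> n)\<bar>)"
      by (simp add: sum_subtractf sum_distrib_left)
    also have "\<dots> = 0"
      using \<kappa> sN N unfolding abs_sum by (simp add: field_simps)
    finally show "(\<Sum>n<q. f n * cos (\<psi> n)) = 0" .
  qed
  show ?sin
  proof (rule periodic_partial_sums_bounded[OF \<open>q > 0\<close>])
    show "f (n + q) * sin (\<psi> (n + q)) = f n * sin (\<psi> n)" for n
      unfolding fs full ..
    have "(\<Sum>n<q. f n * sin (\<psi> n)) = (\<Sum>n<N. a * (sgn (sin (2 * \<psi> n)) * cos (2 * \<psi> n)))"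
      unfolding half fs anti by (intro sum.cong refl) (simp add: sgn_minus field_simps)
    also have "\<dots> = 0"
      unfolding sum_distrib_left[symmetric] cos_sum by simp
    finally show "(\<Sum>n<q. f n * sin (\<psi> n)) = 0" .
  qed
  let ?R = "range (\<lambda>n. \<bar>sin (2 * \<psi> n)\<bar>)"
  have "finite ?R"
    by (rule periodic_range_finite[OF \<open>q > 0\<close>]) (simp add: full)
  moreover have "0 < \<bar>sin (2 * \<psi> n)\<bar>" for n
  proof -
    have "\<bar>sin (2 * \<psi> n)\<bar> = \<bar>sin (y (int (nat ((int n * int p) mod int N))))\<bar>"
      using int_periodic_eq_mod[of "\<lambda>m. \<bar>sin (y m)\<bar>" "int N" "int n * int p"] N
      by (simp add: \<psi>y y_shift)
    moreover have "nat ((int n * int p) mod int N) < N"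
      using N by (simp add: nat_less_iff)
    ultimately show ?thesis using y_pos by (metis less_irrefl zero_less_abs_iff)
  qed
  ultimately have "0 < Min ?R" "\<And>n. Min ?R \<le> \<bar>sin (2 * \<psi> n)\<bar>"
    by auto
  then show "\<exists>\<delta>>0. \<forall>n. \<delta> \<le> \<bar>sin (2 * \<psi> n)\<bar>" by blast
qed

text \<open>
  The ansatz with \<open>\<alpha> n = sin (\<psi> n)\<close> at the optimal phase. There \<open>\<bar>sin (2 * \<psi> n)\<bar>\<close> is bounded below, and
  therefore so is \<open>\<bar>\<alpha> n\<bar>\<close>; since the signs \<open>s n\<close> never vanish, \<open>\<bar>n * V n\<bar>\<close> has the limit \<open>\<bar>a\<bar>\<close>.
\<close>

lemma rational_decaying_tail:
  fixes p q :: nat and a \<eta> \<kappa> :: real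
  assumes "even q" "q > 0" "coprime p q" "\<eta> = pi * real p / real q" "sin \<eta> \<noteq> 0"
    and "\<kappa> * sin \<eta> * (real q * sin (pi / real q)) = a"
  obtains t :: "nat \<Rightarrow> real" and C where "\<forall>\<^sub>F n in sequentially. t n \<noteq> 0"
    "\<And>n. \<bar>t n\<bar> \<le> C * real n powr - \<kappa>"
    "(\<lambda>n. \<bar>real n * (2 * cos \<eta> - (t (n + 1) + t (n - 1)) / t n)\<bar>) \<longlonglongrightarrow> \<bar>a\<bar>"
proof -
  define \<psi> where "\<psi> n = pi / (2 * real q) + real n * \<eta>" for n
  define s where "s n = sgn (sin (2 * \<psi> n))" for n
  define \<alpha> where "\<alpha> n = sin (\<psi> n)" for n
  define f where "f n = 2 * \<kappa> * sin \<eta> * cos (\<psi> n) - a * s n * \<alpha> n" for n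
  note sums = resonant_periodic_sums[OF assms(1-4,6), folded \<psi>_def, folded s_def, folded \<alpha>_def, folded f_def]
  obtain B1 B2 where B: "\<forall>n. \<bar>\<Sum>j<n. f j * cos (\<psi> j)\<bar> \<le> B1" "\<forall>n. \<bar>\<Sum>j<n. f j * sin (\<psi> j)\<bar> \<le> B2"
    using sums(1,2) unfolding \<alpha>_def by blast
  obtain \<beta> where \<beta>: "Bseq \<beta>" "\<And>n. \<beta> (Suc (Suc n)) + \<beta> n - 2 * cos \<eta> * \<beta> (Suc n) = f (Suc n)"
    using forced_oscillator_bounded[OF \<open>sin \<eta> \<noteq> 0\<close> B[unfolded \<psi>_def]] by blast
  obtain \<delta> where \<delta>: "\<delta> > 0" "\<And>n. \<delta> \<le> \<bar>sin (2 * \<psi> n)\<bar>"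
    using sums(3) unfolding \<psi>_def by blast
  have \<alpha>_away: "\<delta> / 2 \<le> \<bar>\<alpha> n\<bar>" for n
  proof -
    have "\<bar>sin (2 * \<psi> n)\<bar> = 2 * (\<bar>\<alpha> n\<bar> * \<bar>cos (\<psi> n)\<bar>)"
      by (simp add: sin_double \<alpha>_def abs_mult)
    also have "\<dots> \<le> 2 * (\<bar>\<alpha> n\<bar> * 1)"
      by (intro mult_left_mono) auto
    finally show ?thesis using \<delta>(2)[of n] by simp
  qed
  have s1: "\<bar>s n\<bar> = 1" for n
    using \<delta>(1) \<delta>(2)[of n] by (auto simp: s_def abs_sgn_eq)
  have \<psi>: "\<psi> n = \<psi> (Suc n) - \<eta>" "\<psi> (Suc (Suc n)) = \<psi> (Suc n) + \<eta>" for n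
    by (simp_all add: \<psi>_def algebra_simps)
  have free: "\<alpha> (Suc (Suc n)) + \<alpha> n = 2 * cos \<eta> * \<alpha> (Suc n)" for n
    unfolding \<alpha>_def \<psi>[of n] by (simp add: sin_add sin_diff)
  have "\<alpha> (Suc (Suc n)) - \<alpha> n = 2 * sin \<eta> * cos (\<psi> (Suc n))" for n
    unfolding \<alpha>_def \<psi>[of n] by (simp add: sin_add sin_diff)
  then have forced: "\<beta> (Suc (Suc n)) + \<beta> n - 2 * cos \<eta> * \<beta> (Suc n)
      = \<kappa> * (\<alpha> (Suc (Suc n)) - \<alpha> n) - a * s (Suc n) * \<alpha> (Suc n)" for n
    by (simp add: \<beta>(2) f_def)
  have bd: "Bseq \<alpha>" "Bseq s"
    by (rule BseqI'[of _ 1], simp add: \<alpha>_def s1)+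
  define t where "t n = real n powr - \<kappa> * (\<alpha> n + \<beta> n / real n)" for n
  note wvn = wigner_von_neumann_ansatz[OF free forced bd(1) \<beta>(1) bd(2) _ \<alpha>_away, folded t_def]
  obtain K where K: "\<And>n. \<bar>\<beta> n\<bar> \<le> K"
    using \<beta>(1) by (auto simp: Bseq_def)
  show thesis
  proof
    show "\<forall>\<^sub>F n in sequentially. t n \<noteq> 0"
      using wvn(1) \<delta>(1) by simp
    show "\<bar>t n\<bar> \<le> (1 + K) * real n powr - \<kappa>" for n
    proof (cases "n = 0")
      case False
      have "\<bar>\<alpha> n + \<beta> n / real n\<bar> \<le> \<bar>\<alpha> n\<bar> + \<bar>\<beta> n\<bar> / real n"
        using abs_triangle_ineq[of "\<alpha> n" "\<beta> n / real n"] by simp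
      also have "\<dots> \<le> \<bar>\<alpha> n\<bar> + \<bar>\<beta> n\<bar> / 1"
        using False by (intro add_left_mono divide_left_mono) auto
      also have "\<dots> \<le> 1 + K"
        using K[of n] by (simp add: \<alpha>_def add_mono)
      finally have "\<bar>\<alpha> n + \<beta> n / real n\<bar> * real n powr - \<kappa> \<le> (1 + K) * real n powr - \<kappa>"
        by (rule mult_right_mono) (rule powr_ge_zero)
      then show ?thesis
        by (simp add: t_def abs_mult mult.commute)
    qed (simp add: t_def)
    have "(\<lambda>n. real n * (2 * cos \<eta> - (t (n + 1) + t (n - 1)) / t n) - a * s n) \<longlonglongrightarrow> 0"
      using wvn(2) \<delta>(1) by simp
    then show "(\<lambda>n. \<bar>real n * (2 * cos \<eta> - (t (n + 1) + t (n - 1)) / t n)\<bar>) \<longlonglongrightarrow> \<bar>a\<bar>"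
    proof (rule metric_tendsto_imp_tendsto, intro always_eventually allI)
      fix n
      have "\<bar>\<bar>X\<bar> - \<bar>a\<bar>\<bar> \<le> \<bar>X - a * s n\<bar>" for X
        using abs_triangle_ineq3[of X "a * s n"] by (simp add: abs_mult s1)
      then show "dist \<bar>real n * (2 * cos \<eta> - (t (n + 1) + t (n - 1)) / t n)\<bar> \<bar>a\<bar>
          \<le> dist (real n * (2 * cos \<eta> - (t (n + 1) + t (n - 1)) / t n) - a * s n) 0"
        by (simp add: dist_real_def)
    qed
  qed
qed

text \<open>
  The assumption \<open>strong\<close> says that the solution decays with an exponent \<open>\<kappa> > 1 / 2\<close>, that is, that its
  square is summable.
\<close>

lemma rational_energy_eigenvalue:
  fixes p q :: nat and a \<eta> :: real
  assumes "even q" "q > 0" "coprime p q" "\<eta> = pi * real p / real q" "0 < sin \<eta>"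
    and "a > 0" and strong: "real q * sin (pi / real q) * sin \<eta> < 2 * a"
    and "sin (pi / real q) > 0"
  shows "\<exists>V. (\<lambda>n. \<bar>real n * V n\<bar>) \<longlonglongrightarrow> a \<and> is_eigenvalue V \<theta> (2 * cos \<eta>)"
proof -
  \<comment> \<open>This is \<open>a * A_const q / (2 * sin \<eta>)\<close>, half the decay exponent of \<open>\<bar>w n\<bar>\<^sup>2\<close>.\<close>
  define \<kappa> where "\<kappa> = a / (sin \<eta> * (real q * sin (pi / real q)))"
  have \<kappa>: "\<kappa> * sin \<eta> * (real q * sin (pi / real q)) = a"
    using assms by (simp add: \<kappa>_def)
  have "\<kappa> > 1 / 2"
    using assms by (simp add: \<kappa>_def field_simps)
  have "sin \<eta> \<noteq> 0" using assms by simp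
  from rational_decaying_tail[OF assms(1-4) this \<kappa>]
  obtain t :: "nat \<Rightarrow> real" and C where t: "\<forall>\<^sub>F n in sequentially. t n \<noteq> 0"
    "\<And>n. \<bar>t n\<bar> \<le> C * real n powr - \<kappa>"
    "(\<lambda>n. \<bar>real n * (2 * cos \<eta> - (t (n + 1) + t (n - 1)) / t n)\<bar>) \<longlonglongrightarrow> \<bar>a\<bar>"
    by blast
  have "cos \<theta> \<noteq> 0 \<or> sin \<theta> \<noteq> 0"
    using sin_cos_squared_add[of \<theta>] by force
  from prescribed_tail[OF t(1) this, of "2 * cos \<eta>"]
  obtain u V :: "nat \<Rightarrow> real" where u: "u 0 = cos \<theta>" "u 1 = sin \<theta>"
    "\<And>n. n \<ge> 1 \<Longrightarrow> u (n + 1) + u (n - 1) + V n * u n = 2 * cos \<eta> * u n"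
    "\<forall>\<^sub>F n in sequentially. u n = t n"
    "\<forall>\<^sub>F n in sequentially. V n = 2 * cos \<eta> - (t (n + 1) + t (n - 1)) / t n"
    by blast
  have "summable (\<lambda>n. C\<^sup>2 * real n powr (- (2 * \<kappa>)))"
    using \<open>\<kappa> > 1 / 2\<close> by (intro summable_mult) (simp add: summable_real_powr_iff)
  moreover have "\<forall>\<^sub>F n in sequentially. norm ((u n)\<^sup>2) \<le> C\<^sup>2 * real n powr (- (2 * \<kappa>))"
    using u(4)
  proof eventually_elim
    case (elim n)
    have "(t n)\<^sup>2 \<le> (C * real n powr - \<kappa>)\<^sup>2"
      using power_mono[OF t(2), of n 2] by simp
    also have "\<dots> = C\<^sup>2 * real n powr (- (2 * \<kappa>))"
      by (simp add: power_mult_distrib power2_eq_square powr_add[symmetric])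
    finally show ?case using elim by simp
  qed
  ultimately have "summable (\<lambda>n. (u n)\<^sup>2)"
    by (rule summable_comparison_test_ev[rotated])
  then have "is_eigenvalue V \<theta> (2 * cos \<eta>)"
    using u by (intro is_eigenvalueI_real) auto
  moreover have "(\<lambda>n. \<bar>real n * V n\<bar>) \<longlonglongrightarrow> a"
  proof (rule Lim_transform_eventually)
    show "(\<lambda>n. \<bar>real n * (2 * cos \<eta> - (t (n + 1) + t (n - 1)) / t n)\<bar>) \<longlonglongrightarrow> a"
      using t(3) \<open>a > 0\<close> by simp
    show "\<forall>\<^sub>F n in sequentially. \<bar>real n * (2 * cos \<eta> - (t (n + 1) + t (n - 1)) / t n)\<bar> = \<bar>real n * V n\<bar>"
      using u(5) by eventually_elim simp
  qed
  ultimately show ?thesis by blast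
qed

section \<open>Irrational energies\<close>

text \<open>
  The sum of \<open>g n - g (n + L)\<close> telescopes with stride \<open>L\<close> and is bounded by the first \<open>L\<close> values.
\<close>

lemma summable_of_strided_decrease:
  fixes g D :: "nat \<Rightarrow> real"
  assumes "c > 0" and g: "\<And>n. n \<ge> n0 \<Longrightarrow> 0 \<le> g n" and D: "\<And>n. 0 \<le> D n"
    and dec: "\<And>n. n \<ge> n0 \<Longrightarrow> g (n + L) + c * D n \<le> g n"
  shows "summable D"
proof -
  have tele: "(\<Sum>i<m. h i - h (i + L)) = (\<Sum>i<L. h i) - (\<Sum>i<L. h (m + i))" for h :: "nat \<Rightarrow> real" and m
  proof (induction m)
    case (Suc m)
    have "h m - h (m + L) = (\<Sum>i<L. h (m + i) - h (m + Suc i))"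
      using sum_lessThan_telescope'[of "\<lambda>i. h (m + i)" L] by simp
    then show ?case using Suc by (simp add: sum_subtractf)
  qed simp
  have "summable (\<lambda>i. D (i + n0))"
  proof (rule summableI_nonneg_bounded)
    fix m
    have "(\<Sum>i<m. c * D (i + n0)) \<le> (\<Sum>i<m. g (i + n0) - g (i + L + n0))"
    proof (rule sum_mono)
      fix i
      show "c * D (i + n0) \<le> g (i + n0) - g (i + L + n0)"
        using dec[of "i + n0"] by (simp add: ac_simps)
    qed
    also have "\<dots> = (\<Sum>i<L. g (i + n0)) - (\<Sum>i<L. g (m + i + n0))"
      using tele[of "\<lambda>i. g (i + n0)"] by simp
    also have "\<dots> \<le> (\<Sum>i<L. g (i + n0))"
      using g by (simp add: sum_nonneg)
    finally show "(\<Sum>i<m. D (i + n0)) \<le> (\<Sum>i<L. g (i + n0)) / c"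
      using \<open>c > 0\<close> by (simp add: field_simps flip: sum_distrib_left)
  qed (use D in simp)
  then show ?thesis by (simp add: summable_iff_shift)
qed

text \<open>
  The Lyapunov function \<open>g n = (n - 1) * \<bar>w n\<bar>\<^sup>2\<close> changes in one step by at most
  \<open>\<bar>w n\<bar>\<^sup>2 - \<tau> * \<bar>Im ((w n)\<^sup>2)\<bar>\<close> up to a term of order \<open>\<bar>w n\<bar>\<^sup>2 / n\<close>. Over \<open>L\<close> steps the orbit differs from
  the pure rotation of \<open>w n\<close> by order \<open>\<bar>w n\<bar> / n\<close>, so by \<open>avg\<close> the total change is at most
  \<open>L * (1 - \<tau> * \<mu>) * \<bar>w n\<bar>\<^sup>2\<close> up to order \<open>\<bar>w n\<bar>\<^sup>2 / n\<close>. As \<open>\<tau> * \<mu> > 1\<close>, the function \<open>g\<close> drops by a fixed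
  multiple of \<open>\<bar>w n\<bar>\<^sup>2\<close>, and summing these drops gives the claim.
\<close>

lemma feedback_orbit_square_summable:
  fixes w :: "nat \<Rightarrow> complex" and s :: "nat \<Rightarrow> real" and \<tau> \<mu> \<eta> :: real
  assumes step: "\<And>n. w (Suc n) = cis \<eta> * (w n - of_real (\<tau> / real n * s n * Im (w n)))"
    and sgn: "\<And>n. s n * (Re (w n) * Im (w n)) = \<bar>Re (w n) * Im (w n)\<bar>" "\<And>n. \<bar>s n\<bar> = 1"
    and "L > 0" and avg: "\<And>x. \<mu> * real L \<le> (\<Sum>j<L. \<bar>sin (x + 2 * \<eta> * real j)\<bar>)"
    and "\<tau> > 0" "\<tau> * \<mu> > 1"
  shows "summable (\<lambda>n. (cmod (w n))\<^sup>2)"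
proof -
  define D where "D n = (cmod (w n))\<^sup>2" for n
  have D0: "D n \<ge> 0" for n by (simp add: D_def)
  have D_step: "D (Suc n) \<le> D n - \<tau> / real n * \<bar>Im ((w n)\<^sup>2)\<bar> + (\<tau> / real n)\<^sup>2 * D n" for n
  proof -
    have "(s n)\<^sup>2 = 1"
      using sgn(2)[of n] by (metis power2_abs one_power2)
    have "D (Suc n) = (Re (w n) - \<tau> / real n * s n * Im (w n))\<^sup>2 + (Im (w n))\<^sup>2"
      by (simp add: D_def step norm_mult cmod_power2)
    also have "\<dots> = D n - 2 * (\<tau> / real n) * (s n * (Re (w n) * Im (w n))) + (\<tau> / real n)\<^sup>2 * (s n)\<^sup>2 * (Im (w n))\<^sup>2"
      by (simp add: D_def cmod_power2) (simp add: power2_eq_square algebra_simps)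
    also have "\<dots> = D n - \<tau> / real n * \<bar>Im ((w n)\<^sup>2)\<bar> + (\<tau> / real n)\<^sup>2 * (Im (w n))\<^sup>2"
      unfolding sgn(1) \<open>(s n)\<^sup>2 = 1\<close> by (simp add: power2_eq_square abs_mult)
    also have "\<dots> \<le> D n - \<tau> / real n * \<bar>Im ((w n)\<^sup>2)\<bar> + (\<tau> / real n)\<^sup>2 * D n"
      by (intro add_left_mono mult_left_mono) (simp_all add: D_def cmod_power2)
    finally show ?thesis .
  qed
  have w_step: "cmod (w (Suc n) - cis \<eta> * w n) \<le> \<tau> / real n * cmod (w n)" for n
  proof -
    have "w (Suc n) - cis \<eta> * w n = - cis \<eta> * of_real (\<tau> / real n * s n * Im (w n))"
      unfolding step by (simp add: algebra_simps)
    then have "cmod (w (Suc n) - cis \<eta> * w n) = \<tau> / real n * \<bar>Im (w n)\<bar>"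
      using \<open>\<tau> > 0\<close> sgn(2)[of n] by (simp add: norm_mult abs_mult norm_divide)
    then show ?thesis
      using \<open>\<tau> > 0\<close> abs_Im_le_cmod[of "w n"] by (simp add: divide_right_mono mult_left_mono)
  qed
  have growth: "cmod (w (n + j)) \<le> (1 + \<tau>) ^ j * cmod (w n)" if "n \<ge> 1" for n j
  proof (induction j)
    case (Suc j)
    have "cmod (w (n + Suc j)) \<le> cmod (cis \<eta> * w (n + j)) + cmod (w (Suc (n + j)) - cis \<eta> * w (n + j))"
      using norm_triangle_sub[of "w (Suc (n + j))" "cis \<eta> * w (n + j)"] by simp
    also have "\<dots> \<le> cmod (w (n + j)) + \<tau> / real (n + j) * cmod (w (n + j))"
      using w_step[of "n + j"] by (simp add: norm_mult)
    also have "\<dots> \<le> cmod (w (n + j)) + \<tau> / 1 * cmod (w (n + j))"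
      using that \<open>\<tau> > 0\<close> by (intro add_left_mono mult_right_mono divide_left_mono) auto
    also have "\<dots> = (1 + \<tau>) * cmod (w (n + j))"
      by (simp add: algebra_simps)
    also have "\<dots> \<le> (1 + \<tau>) * ((1 + \<tau>) ^ j * cmod (w n))"
      using Suc \<open>\<tau> > 0\<close> by (intro mult_left_mono) auto
    finally show ?case by (simp add: mult.assoc)
  qed simp
  have drift: "cmod (w (n + j) - cis (real j * \<eta>) * w n) \<le> real j * \<tau> * (1 + \<tau>) ^ j / real n * cmod (w n)"
    if "n \<ge> 1" for n j
  proof (induction j)
    case (Suc j)
    have split: "w (n + Suc j) - cis (real (Suc j) * \<eta>) * w n
        = (w (Suc (n + j)) - cis \<eta> * w (n + j)) + cis \<eta> * (w (n + j) - cis (real j * \<eta>) * w n)"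
      by (simp add: algebra_simps cis_mult[symmetric])
    have "cmod (w (n + Suc j) - cis (real (Suc j) * \<eta>) * w n)
        \<le> cmod (w (Suc (n + j)) - cis \<eta> * w (n + j)) + cmod (w (n + j) - cis (real j * \<eta>) * w n)"
      unfolding split
      using norm_triangle_ineq[of "w (Suc (n + j)) - cis \<eta> * w (n + j)" "cis \<eta> * (w (n + j) - cis (real j * \<eta>) * w n)"]
      by (simp add: norm_mult)
    also have "\<dots> \<le> \<tau> / real n * ((1 + \<tau>) ^ j * cmod (w n)) + real j * \<tau> * (1 + \<tau>) ^ j / real n * cmod (w n)"
    proof (intro add_mono Suc)
      have "cmod (w (Suc (n + j)) - cis \<eta> * w (n + j)) \<le> \<tau> / real (n + j) * cmod (w (n + j))"
        by (rule w_step)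
      also have "\<dots> \<le> \<tau> / real n * ((1 + \<tau>) ^ j * cmod (w n))"
        using that \<open>\<tau> > 0\<close> growth[OF that, of j] by (intro mult_mono divide_left_mono) auto
      finally show "cmod (w (Suc (n + j)) - cis \<eta> * w (n + j)) \<le> \<tau> / real n * ((1 + \<tau>) ^ j * cmod (w n))" .
    qed
    also have "\<dots> = real (Suc j) * \<tau> * (1 + \<tau>) ^ j / real n * cmod (w n)"
      by (simp add: algebra_simps add_divide_distrib)
    also have "\<dots> \<le> real (Suc j) * \<tau> * (1 + \<tau>) ^ Suc j / real n * cmod (w n)"
      using \<open>\<tau> > 0\<close> by (intro mult_right_mono divide_right_mono mult_left_mono power_increasing) auto
    finally show ?case .
  qed simp
  define M where "M = (1 + \<tau>) ^ L"
  define K where "K = real L * \<tau> * M * (M + 1)"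
  have "M \<ge> 1" using \<open>\<tau> > 0\<close> by (simp add: M_def)
  have block: "\<bar>Im ((w (n + j))\<^sup>2)\<bar> \<ge> \<bar>Im (cis (real j * \<eta>) ^ 2 * (w n)\<^sup>2)\<bar> - K / real n * D n"
    "D (n + j) \<le> D n + K / real n * D n" "D (n + j) \<le> M\<^sup>2 * D n"
    if "n \<ge> 1" "j < L" for n j
  proof -
    let ?z = "cis (real j * \<eta>) * w n"
    have "cmod (w (n + j)) \<le> (1 + \<tau>) ^ j * cmod (w n)"
      by (rule growth[OF \<open>n \<ge> 1\<close>])
    also have "\<dots> \<le> M * cmod (w n)"
      unfolding M_def using that \<open>\<tau> > 0\<close> by (intro mult_right_mono power_increasing) auto
    finally have gM: "cmod (w (n + j)) \<le> M * cmod (w n)" .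
    have "cmod (w (n + j) - ?z) \<le> real j * \<tau> * (1 + \<tau>) ^ j / real n * cmod (w n)"
      by (rule drift[OF \<open>n \<ge> 1\<close>])
    also have "\<dots> \<le> real L * \<tau> * M / real n * cmod (w n)"
      unfolding M_def using that \<open>\<tau> > 0\<close>
      by (intro mult_right_mono divide_right_mono mult_mono power_increasing) auto
    finally have dM: "cmod (w (n + j) - ?z) \<le> real L * \<tau> * M / real n * cmod (w n)" .
    have "(w (n + j))\<^sup>2 - ?z\<^sup>2 = (w (n + j) - ?z) * (w (n + j) + ?z)"
      by (simp add: power2_eq_square algebra_simps)
    then have "cmod ((w (n + j))\<^sup>2 - ?z\<^sup>2) = cmod (w (n + j) - ?z) * cmod (w (n + j) + ?z)"
      by (simp add: norm_mult)
    also have "cmod (w (n + j) + ?z) \<le> (M + 1) * cmod (w n)"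
      using norm_triangle_ineq[of "w (n + j)" ?z] gM by (simp add: norm_mult algebra_simps)
    also have "cmod (w (n + j) - ?z) * ((M + 1) * cmod (w n))
        \<le> (real L * \<tau> * M / real n * cmod (w n)) * ((M + 1) * cmod (w n))"
      using \<open>M \<ge> 1\<close> by (intro mult_right_mono dM) auto
    also have "\<dots> = K / real n * D n"
      by (simp add: K_def D_def power2_eq_square)
    finally have sq: "cmod ((w (n + j))\<^sup>2 - ?z\<^sup>2) \<le> K / real n * D n"
      by (simp add: mult_left_mono)
    show "\<bar>Im ((w (n + j))\<^sup>2)\<bar> \<ge> \<bar>Im (cis (real j * \<eta>) ^ 2 * (w n)\<^sup>2)\<bar> - K / real n * D n"
      using abs_Im_le_cmod[of "(w (n + j))\<^sup>2 - ?z\<^sup>2"] sq by (simp add: power_mult_distrib)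
    show "D (n + j) \<le> D n + K / real n * D n"
      using norm_triangle_ineq2[of "(w (n + j))\<^sup>2" "?z\<^sup>2"] sq
      by (simp add: D_def norm_mult norm_power power_mult_distrib)
    show "D (n + j) \<le> M\<^sup>2 * D n"
      using power_mono[OF gM, of 2] by (simp add: D_def power_mult_distrib)
  qed
  have rotation: "\<bar>Im (cis (real j * \<eta>) ^ 2 * z\<^sup>2)\<bar> = (cmod z)\<^sup>2 * \<bar>sin (2 * Arg z + 2 * \<eta> * real j)\<bar>" for j z
  proof -
    have sq: "(cis x)\<^sup>2 = cis (2 * x)" for x
      by (simp add: power2_eq_square cis_mult)
    have "z = of_real (cmod z) * cis (Arg z)"
      using rcis_cmod_Arg[of z] by (simp add: rcis_def)
    then have "z\<^sup>2 = (of_real (cmod z) * cis (Arg z))\<^sup>2"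
      by (rule arg_cong)
    also have "\<dots> = of_real ((cmod z)\<^sup>2) * cis (2 * Arg z)"
      by (simp add: power_mult_distrib sq)
    finally have "cis (real j * \<eta>) ^ 2 * z\<^sup>2 = of_real ((cmod z)\<^sup>2) * (cis (2 * (real j * \<eta>)) * cis (2 * Arg z))"
      by (simp add: sq)
    also have "cis (2 * (real j * \<eta>)) * cis (2 * Arg z) = cis (2 * Arg z + 2 * \<eta> * real j)"
      unfolding cis_mult by (simp add: algebra_simps)
    finally have "cis (real j * \<eta>) ^ 2 * z\<^sup>2 = of_real ((cmod z)\<^sup>2) * cis (2 * Arg z + 2 * \<eta> * real j)" .
    then show ?thesis
      by (simp add: abs_mult del: of_real_power)
  qed
  define g where "g n = (real n - 1) * D n" for n
  define K' where "K' = K + \<tau> * K + \<tau>\<^sup>2 * M\<^sup>2"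
  have g_step: "g (Suc n) - g n \<le> D n - \<tau> * \<bar>Im ((w n)\<^sup>2)\<bar> + \<tau>\<^sup>2 / real n * D n" if "n \<ge> 1" for n
  proof -
    have "real n * D (Suc n) \<le> real n * (D n - \<tau> / real n * \<bar>Im ((w n)\<^sup>2)\<bar> + (\<tau> / real n)\<^sup>2 * D n)"
      by (intro mult_left_mono D_step) auto
    also have "\<dots> = real n * D n - \<tau> * \<bar>Im ((w n)\<^sup>2)\<bar> + \<tau>\<^sup>2 / real n * D n"
      using that by (simp add: field_simps power2_eq_square)
    finally show ?thesis by (simp add: g_def algebra_simps)
  qed
  have g_block: "g (n + L) - g n \<le> D n * real L * (1 - \<tau> * \<mu> + K' / real n)" if n: "n \<ge> 1" for n
  proof -
    let ?\<sigma> = "\<lambda>j. \<bar>sin (2 * Arg (w n) + 2 * \<eta> * real j)\<bar>"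
    have "g (n + L) - g n = (\<Sum>j<L. g (n + Suc j) - g (n + j))"
      using sum_lessThan_telescope[of "\<lambda>j. g (n + j)" L] by simp
    also have "\<dots> \<le> (\<Sum>j<L. D n * (1 + K' / real n - \<tau> * ?\<sigma> j))"
    proof (rule sum_mono)
      fix j assume "j \<in> {..<L}"
      then have j: "j < L" by simp
      have "g (n + Suc j) - g (n + j)
          \<le> D (n + j) - \<tau> * \<bar>Im ((w (n + j))\<^sup>2)\<bar> + \<tau>\<^sup>2 / real (n + j) * D (n + j)"
        using g_step[of "n + j"] n by simp
      also have "\<dots> \<le> (D n + K / real n * D n) - \<tau> * (D n * ?\<sigma> j - K / real n * D n)
          + \<tau>\<^sup>2 / real n * (M\<^sup>2 * D n)"
      proof (intro add_mono diff_mono mult_left_mono)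
        show "\<tau>\<^sup>2 / real (n + j) * D (n + j) \<le> \<tau>\<^sup>2 / real n * (M\<^sup>2 * D n)"
          using n block(3)[OF n j] D0 by (intro mult_mono divide_left_mono) auto
        show "D n * ?\<sigma> j - K / real n * D n \<le> \<bar>Im ((w (n + j))\<^sup>2)\<bar>"
          using block(1)[OF n j] rotation[of j "w n"] by (simp add: D_def)
      qed (use block(2)[OF n j] \<open>\<tau> > 0\<close> in auto)
      also have "\<dots> = D n * (1 + K' / real n - \<tau> * ?\<sigma> j)"
        by (simp add: K'_def algebra_simps add_divide_distrib)
      finally show "g (n + Suc j) - g (n + j) \<le> D n * (1 + K' / real n - \<tau> * ?\<sigma> j)" .
    qed
    also have "\<dots> = D n * (real L * (1 + K' / real n) - \<tau> * (\<Sum>j<L. ?\<sigma> j))"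
      by (simp add: sum_subtractf flip: sum_distrib_left)
    also have "\<dots> \<le> D n * (real L * (1 + K' / real n) - \<tau> * (\<mu> * real L))"
      using D0 \<open>\<tau> > 0\<close> by (intro mult_left_mono diff_left_mono avg) auto
    also have "\<dots> = D n * real L * (1 - \<tau> * \<mu> + K' / real n)"
      by (simp add: algebra_simps)
    finally show ?thesis .
  qed
  define c where "c = (\<tau> * \<mu> - 1) / 2"
  have "c > 0" using assms by (simp add: c_def)
  have "(\<lambda>n. K' / real n) \<longlonglongrightarrow> 0"
    by (rule lim_const_over_n)
  then have "\<forall>\<^sub>F n in sequentially. K' / real n < c"
    using \<open>c > 0\<close> by (rule order_tendstoD(2))
  then obtain n1 where n1: "\<And>n. n \<ge> n1 \<Longrightarrow> K' / real n < c"
    by (auto simp: eventually_sequentially)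
  have "summable D"
  proof (rule summable_of_strided_decrease)
    show "real L * c > 0" using \<open>L > 0\<close> \<open>c > 0\<close> by simp
    fix n assume n: "n \<ge> max 1 n1"
    then show "0 \<le> g n" using D0 by (simp add: g_def)
    have "D n * real L * (1 - \<tau> * \<mu> + K' / real n) \<le> D n * real L * (- c)"
      using n1[of n] n D0 by (intro mult_left_mono) (auto simp: c_def field_simps)
    then show "g (n + L) + real L * c * D n \<le> g n"
      using g_block[of n] n by (simp add: algebra_simps)
  qed (rule D0)
  then show ?thesis by (simp add: D_def[abs_def])
qed

text \<open>
  Unlike \<open>sgn\<close> this never vanishes, so that \<open>\<bar>n * V n\<bar>\<close> is equal to \<open>a\<close> for all \<open>n \<ge> 1\<close>.
\<close>

definition push_sign :: "complex \<Rightarrow> real" where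
  "push_sign z = (if Re z * Im z \<ge> 0 then 1 else - 1)"

text \<open>
  As \<open>\<tau> / 0 = 0\<close>, the step from \<open>0\<close> to \<open>1\<close> is a free rotation; this encodes both \<open>u 0\<close> and \<open>u 1\<close> in the
  initial value.
\<close>

primrec feedback_orbit :: "real \<Rightarrow> real \<Rightarrow> complex \<Rightarrow> nat \<Rightarrow> complex" where
  "feedback_orbit \<tau> \<eta> z 0 = z"
| "feedback_orbit \<tau> \<eta> z (Suc n) = cis \<eta> * (feedback_orbit \<tau> \<eta> z n
     - of_real (\<tau> / real n * push_sign (feedback_orbit \<tau> \<eta> z n) * Im (feedback_orbit \<tau> \<eta> z n)))"

text \<open>
  The orbit encodes \<open>u n = Im (w n) / sin \<eta>\<close>. The real part of \<open>w n\<close> carries \<open>u (n - 1)\<close>, because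
  \<open>Im (cis (- \<eta>) * w n) = Im (w (n - 1))\<close>, and this turns the recursion for \<open>w\<close> into the eigenvalue equation.
\<close>

lemma irrational_energy_eigenvalue:
  fixes k a \<eta> :: real
  assumes "k \<notin> \<rat>" "\<eta> = pi * k" "0 < sin \<eta>" "a > 0" and strong: "sin \<eta> < a * (2 / pi)"
  shows "\<exists>V. (\<lambda>n. \<bar>real n * V n\<bar>) \<longlonglongrightarrow> a \<and> is_eigenvalue V \<theta> (2 * cos \<eta>)"
proof -
  define \<tau> where "\<tau> = a / sin \<eta>"
  have "\<tau> > 0" "1 / \<tau> < 2 / pi"
    using assms by (auto simp: \<tau>_def field_simps)
  \<comment> \<open>Any average slightly below \<open>2 / pi\<close> will do: the strict inequality leaves room for \<open>\<tau> * \<mu> > 1\<close>.\<close>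
  then obtain \<mu> where \<mu>: "1 / \<tau> < \<mu>" "\<mu> < 2 / pi"
    using dense by blast
  have "2 * k \<notin> \<rat>"
  proof
    assume "2 * k \<in> \<rat>"
    then have "2 * k / 2 \<in> \<rat>" by (rule Rats_divide) simp
    then show False using assms by simp
  qed
  from cesaro_abs_sin_irrational[OF this \<mu>(2)]
  obtain L where L: "L > 0" "\<And>x. \<mu> * real L \<le> (\<Sum>j<L. \<bar>sin (x + pi * (2 * k) * real j)\<bar>)"
    by blast
  define w where "w = feedback_orbit \<tau> \<eta> (of_real (sin \<theta>) - cis (- \<eta>) * of_real (cos \<theta>))"
  define s where "s n = push_sign (w n)" for n
  define V where "V n = a / real n * s n" for n
  define u where "u n = Im (w n) / sin \<eta>" for n
  have step: "w (Suc n) = cis \<eta> * (w n - of_real (\<tau> / real n * s n * Im (w n)))" for n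
    by (simp add: w_def s_def)
  have s: "\<bar>s n\<bar> = 1" "s n * (Re (w n) * Im (w n)) = \<bar>Re (w n) * Im (w n)\<bar>" for n
    by (auto simp: s_def push_sign_def)
  have "summable (\<lambda>n. (cmod (w n))\<^sup>2)"
  proof (rule feedback_orbit_square_summable[OF step s(2,1) L(1) _ \<open>\<tau> > 0\<close>])
    show "\<mu> * real L \<le> (\<Sum>j<L. \<bar>sin (x + 2 * \<eta> * real j)\<bar>)" for x
      using L(2)[of x] by (simp add: assms(2) mult_ac)
    show "\<tau> * \<mu> > 1" using \<mu>(1) \<open>\<tau> > 0\<close> by (simp add: field_simps)
  qed
  then have "summable (\<lambda>n. (u n)\<^sup>2)"
  proof (rule summable_comparison_test'[OF summable_divide[where c = "(sin \<eta>)\<^sup>2"]])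
    fix n
    show "norm ((u n)\<^sup>2) \<le> (cmod (w n))\<^sup>2 / (sin \<eta>)\<^sup>2"
      by (simp add: u_def power_divide divide_right_mono cmod_power2)
  qed
  moreover have "u 0 = cos \<theta>" "u 1 = sin \<theta>"
  proof -
    show "u 0 = cos \<theta>"
      using assms by (simp add: u_def w_def)
    have "w 1 = cis \<eta> * of_real (sin \<theta>) - of_real (cos \<theta>)"
      using step[of 0] by (simp add: w_def algebra_simps cis_mult flip: mult.assoc)
    then show "u 1 = sin \<theta>"
      using assms by (simp add: u_def)
  qed
  moreover have "u (n + 1) + u (n - 1) + V n * u n = 2 * cos \<eta> * u n" if "n \<ge> 1" for n
  proof -
    obtain m where m: "n = Suc m" using \<open>n \<ge> 1\<close> by (cases n) auto
    have "cis (- \<eta>) * w n = w m - of_real (\<tau> / real m * s m * Im (w m))"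
      unfolding m step by (simp add: cis_mult flip: mult.assoc)
    then have "Im (cis (- \<eta>) * w n) = Im (w m)"
      by simp
    then have prev: "cos \<eta> * Im (w n) - sin \<eta> * Re (w n) = Im (w m)"
      by simp
    have "next": "Im (w (Suc n)) = cos \<eta> * Im (w n) + sin \<eta> * (Re (w n) - \<tau> / real n * s n * Im (w n))"
      unfolding step by simp
    have V: "sin \<eta> * (\<tau> / real n * s n) = V n"
      using assms by (simp add: V_def \<tau>_def)
    have "Im (w (Suc n)) + Im (w m) + V n * Im (w n) = 2 * cos \<eta> * Im (w n)"
      unfolding "next" prev[symmetric] V[symmetric] by (simp add: algebra_simps)
    then have "(Im (w (Suc n)) + Im (w m) + V n * Im (w n)) / sin \<eta> = 2 * cos \<eta> * Im (w n) / sin \<eta>"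
      by simp
    then show ?thesis
      by (simp add: u_def m add_divide_distrib)
  qed
  ultimately have "is_eigenvalue V \<theta> (2 * cos \<eta>)"
    by (intro is_eigenvalueI_real) auto
  moreover have "(\<lambda>n. \<bar>real n * V n\<bar>) \<longlonglongrightarrow> a"
  proof (rule tendsto_eventually)
    show "\<forall>\<^sub>F n in sequentially. \<bar>real n * V n\<bar> = a"
      using eventually_gt_at_top[of 0]
      by eventually_elim (use \<open>a > 0\<close> in \<open>simp add: V_def abs_mult s\<close>)
  qed
  ultimately show ?thesis by blast
qed

section \<open>Eigenvalues for all admissible energies\<close>

theorem theorem2p4:
  fixes q :: nat and a E \<theta> :: real
  assumes "even q"
    and "0 < a" and "a < 1 / A_const q"
    and "E \<in> energy_set q"
    and "E \<in> {-2<..<- E_threshold q a} \<union> {E_threshold q a<..<2}"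
    and "\<theta> \<in> {0..pi}"
  shows "\<exists>V :: nat \<Rightarrow> real.
           limsup (\<lambda>n. ereal \<bar>real n * V n\<bar>) = ereal a \<and> is_eigenvalue V \<theta> E"
proof -
  define k where "k = quasimomentum E"
  define \<eta> where "\<eta> = pi * k"
  have E2: "-2 < E" "E < 2"
    using assms(4) by (auto simp: energy_set_def split: if_splits)
  have k: "0 < k" "k < 1" "E = 2 * cos \<eta>"
    using theI'[OF quasimomentum_ex1[OF E2]] by (auto simp: k_def \<eta>_def quasimomentum_def)
  have S: "0 < sin \<eta>"
    using k by (intro sin_gt_zero) (auto simp: \<eta>_def)
  have q_cases: "q = 0 \<and> k \<notin> \<rat> \<or> q \<ge> 2 \<and> (\<exists>p. coprime p q \<and> k = real p / real q)"
    using assms(1,4) by (auto simp: energy_set_def k_def split: if_splits elim!: evenE)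
  have sq: "sin (pi / real q) > 0" if "q \<ge> 2"
    using that by (intro sin_gt_zero) (auto simp: field_simps)
  have A: "A_const q > 0"
    using q_cases sq by (auto simp: A_const_def)
  \<comment> \<open>Since \<open>(E / 2)\<^sup>2 = 1 - (sin \<eta>)\<^sup>2\<close>, the threshold for \<open>E\<close> is a bound on \<open>sin \<eta>\<close>.\<close>
  have "sin \<eta> < a * A_const q"
  proof -
    have "a * A_const q < 1"
      using assms(3) A by (simp add: field_simps)
    then have "0 \<le> 1 - a\<^sup>2 * (A_const q)\<^sup>2"
      using A \<open>0 < a\<close> by (simp add: power_le_one flip: power_mult_distrib)
    moreover have "E_threshold q a < \<bar>E\<bar>"
      using assms(5) by auto
    ultimately have "(2 * sqrt (1 - a\<^sup>2 * (A_const q)\<^sup>2))\<^sup>2 < \<bar>E\<bar>\<^sup>2"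
      unfolding E_threshold_def by (intro power_strict_mono) auto
    then have "4 * (1 - a\<^sup>2 * (A_const q)\<^sup>2) < 4 * (cos \<eta>)\<^sup>2"
      using \<open>0 \<le> 1 - a\<^sup>2 * (A_const q)\<^sup>2\<close> by (simp add: k(3) power_mult_distrib)
    then have "(sin \<eta>)\<^sup>2 < (a * A_const q)\<^sup>2"
      using sin_cos_squared_add[of \<eta>] by (simp add: power_mult_distrib cos_squared_eq)
    then show ?thesis
      by (rule power2_less_imp_less) (use A \<open>0 < a\<close> in simp)
  qed
  then have "\<exists>V. (\<lambda>n. \<bar>real n * V n\<bar>) \<longlonglongrightarrow> a \<and> is_eigenvalue V \<theta> E"
    using q_cases
  proof (elim disjE conjE exE)
    assume "q = 0" "k \<notin> \<rat>" "sin \<eta> < a * A_const q"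
    then show ?thesis
      unfolding k(3) using irrational_energy_eigenvalue[of k \<eta> a \<theta>] S \<open>0 < a\<close>
      by (simp add: A_const_def \<eta>_def)
  next
    fix p assume "q \<ge> 2" and p: "coprime p q" "k = real p / real q" and less: "sin \<eta> < a * A_const q"
    have "real q * sin (pi / real q) * sin \<eta> < 2 * a"
      using less \<open>q \<ge> 2\<close> sq[OF \<open>q \<ge> 2\<close>] by (simp add: A_const_def field_simps)
    then show ?thesis
      unfolding k(3) using rational_energy_eigenvalue[of q p \<eta> a \<theta>] assms(1) \<open>q \<ge> 2\<close> p S \<open>0 < a\<close> sq
      by (simp add: \<eta>_def)
  qed
  then obtain V where V: "(\<lambda>n. \<bar>real n * V n\<bar>) \<longlonglongrightarrow> a" "is_eigenvalue V \<theta> E"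
    by blast
  have "limsup (\<lambda>n. ereal \<bar>real n * V n\<bar>) = ereal a"
    by (rule lim_imp_Limsup) (use V(1) in simp_all)
  with V(2) show ?thesis by blast
qed

end
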